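(* Let $G$ be a graph of order $n\geq 2$ and let $\mu(\overline{G})$ be the spectral radius of its complement $\overline{G}$. If $$\mu(\overline{G})\leq\sqrt{n-1},$$ then $G$ contains a Hamiltonian path unless $G=K_{n-1}+v$. If $$\mu(\overline{G})\leq\sqrt{n-2},$$ then $G$ contains a Hamiltonian cycle unless $G=K_{n-1}+e$.
   Context: Graphs are finite, simple and undirected; the order of a graph is its number of vertices. The spectral radius of a graph is the largest eigenvalue of its adjacency matrix. $\overline{G}$ is the complement of $G$: the graph on the same vertex set in which two distinct vertices are adjacent if and only if they are not adjacent in $G$. $K_{n-1}+v$ denotes the graph of order $n$ consisting of the complete graph on $n-1$ vertices together with an isolated vertex. $K_{n-1}+e$ denotes the graph of order $n$ consisting of the complete graph on $n-1$ vertices with a pendent edge (i.e. one additional vertex joined to exactly one vertex of the complete graph). Equality of graphs means isomorphism. A Hamiltonian path (cycle) is a path (cycle) in $G$ passing through all vertices of $G$; a cycle has at least $3$ vertices. *)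

theory Defs
  imports "Graph_Theory.Graph_Theory" "Jordan_Normal_Form.Char_Poly"
begin

text \<open>
  A finite simple undirected graph is a \<^locale>\<open>pair_graph\<close>: a finite, loop-free digraph whose
  arc set is a symmetric set of pairs, so that an edge uv is the pair of arcs (u, v), (v, u).
  Between such graphs, \<^const>\<open>digraph_iso\<close> is ordinary graph isomorphism.
\<close>

definition complement :: "'a pair_pre_digraph \<Rightarrow> 'a pair_pre_digraph" where
  "complement G = \<lparr> pverts = pverts G,
     parcs = {(u, v). u \<in> pverts G \<and> v \<in> pverts G \<and> u \<noteq> v \<and> (u, v) \<notin> parcs G} \<rparr>"

definition adjacency_matrix :: "'a list \<Rightarrow> 'a pair_pre_digraph \<Rightarrow> real mat" where
  "adjacency_matrix xs G =
     mat (length xs) (length xs) (\<lambda>(i, j). if (xs ! i, xs ! j) \<in> parcs G then 1 else 0)"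

text \<open>
  The adjacency matrix is taken with respect to an arbitrary enumeration of the vertices; its
  eigenvalues do not depend on the enumeration (lemma \<open>eigenvalue_adjacency_matrix_cong\<close> below).
\<close>

definition vertex_enumeration :: "'a pair_pre_digraph \<Rightarrow> 'a list" where
  "vertex_enumeration G = (SOME xs. distinct xs \<and> set xs = pverts G)"

text \<open>
  For a graph with at least one vertex, the set below is finite and nonempty because the matrix
  is real symmetric.
\<close>

definition graph_spectral_radius :: "'a pair_pre_digraph \<Rightarrow> real" where
  "graph_spectral_radius G = Max {k. eigenvalue (adjacency_matrix (vertex_enumeration G) G) k}"

definition complete_graph :: "nat \<Rightarrow> nat pair_pre_digraph" where
  "complete_graph m = \<lparr> pverts = {..<m}, parcs = {(i, j). i < m \<and> j < m \<and> i \<noteq> j} \<rparr>"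

definition complete_plus_vertex :: "nat \<Rightarrow> nat pair_pre_digraph" where
  "complete_plus_vertex m = \<lparr> pverts = insert m (pverts (complete_graph m)),
     parcs = parcs (complete_graph m) \<rparr>"

text \<open>The new vertex \<open>m\<close> is joined to the vertex \<open>0\<close>, which is a vertex of the complete graph
  only if \<open>m \<ge> 1\<close>.\<close>

definition complete_plus_edge :: "nat \<Rightarrow> nat pair_pre_digraph" where
  "complete_plus_edge m = \<lparr> pverts = insert m (pverts (complete_graph m)),
     parcs = parcs (complete_graph m) \<union> {(0, m), (m, 0)} \<rparr>"

definition (in pre_digraph) hamiltonian_path :: "'a \<Rightarrow> 'b awalk \<Rightarrow> 'a \<Rightarrow> bool" where
  "hamiltonian_path u p v \<longleftrightarrow> apath u p v \<and> set (awalk_verts u p) = verts G"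

text \<open>
  The length bound is needed because \<^const>\<open>pre_digraph.cycle\<close> admits the closed walk that
  traverses an edge back and forth. The tails of the arcs of a cycle are exactly its vertices.
\<close>

definition (in pre_digraph) hamiltonian_cycle :: "'b awalk \<Rightarrow> bool" where
  "hamiltonian_cycle p \<longleftrightarrow> cycle p \<and> 3 \<le> length p \<and> tail G ` set p = verts G"

lemma pair_graph_complement:
  assumes "pair_graph G"
  shows "pair_graph (complement G)"
proof -
  interpret pair_graph G by fact
  have "parcs (complement G) \<subseteq> pverts G \<times> pverts G"
    by (auto simp: complement_def)
  then have "finite (parcs (complement G))"
    by (rule finite_subset) simp
  then show ?thesis
    using arcs_symmetric by unfold_locales (auto simp: complement_def symmetric_def intro!: symI)
qed

lemma vertex_enumeration:
  assumes "finite (pverts G)"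
  shows "distinct (vertex_enumeration G)" "set (vertex_enumeration G) = pverts G"
proof -
  have "\<exists>xs. distinct xs \<and> set xs = pverts G"
    using finite_distinct_list[OF assms] by blast
  from someI_ex[OF this] show "distinct (vertex_enumeration G)"
    "set (vertex_enumeration G) = pverts G"
    by (auto simp: vertex_enumeration_def)
qed

lemma eigenvalue_adjacency_matrix_iff:
  assumes "distinct xs"
  shows "eigenvalue (adjacency_matrix xs G) k \<longleftrightarrow>
    (\<exists>f. (\<exists>u \<in> set xs. f u \<noteq> 0) \<and>
         (\<forall>u \<in> set xs. (\<Sum>v | v \<in> set xs \<and> (u, v) \<in> parcs G. f v) = k * f u))"
proof -
  let ?n = "length xs" and ?A = "adjacency_matrix xs G"
  have bij: "bij_betw ((!) xs) {0..<?n} (set xs)"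
    using assms by (simp add: bij_betw_nth atLeast0LessThan)
  have row: "(?A *\<^sub>v vec ?n (\<lambda>i. f (xs ! i))) $ i
      = (\<Sum>v | v \<in> set xs \<and> (xs ! i, v) \<in> parcs G. f v)" if "i < ?n" for f i
  proof -
    have "(?A *\<^sub>v vec ?n (\<lambda>i. f (xs ! i))) $ i
      = (\<Sum>j = 0..<?n. if (xs ! i, xs ! j) \<in> parcs G then f (xs ! j) else 0)"
      using that by (auto simp: adjacency_matrix_def scalar_prod_def intro!: sum.cong)
    also have "\<dots> = (\<Sum>v \<in> set xs. if (xs ! i, v) \<in> parcs G then f v else 0)"
      by (rule sum.reindex_bij_betw[OF bij])
    also have "\<dots> = (\<Sum>v | v \<in> set xs \<and> (xs ! i, v) \<in> parcs G. f v)"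
      by (simp add: sum.inter_filter)
    finally show ?thesis .
  qed
  have dims: "dim_row ?A = ?n" "dim_col ?A = ?n"
    by (simp_all add: adjacency_matrix_def)
  have eq: "eigenvector ?A (vec ?n (\<lambda>i. f (xs ! i))) k \<longleftrightarrow> (\<exists>u \<in> set xs. f u \<noteq> 0) \<and>
    (\<forall>u \<in> set xs. (\<Sum>v | v \<in> set xs \<and> (u, v) \<in> parcs G. f v) = k * f u)" for f
  proof -
    let ?w = "vec ?n (\<lambda>i. f (xs ! i))"
    have "?w \<noteq> 0\<^sub>v ?n \<longleftrightarrow> (\<exists>u \<in> set xs. f u \<noteq> 0)"
      by (auto simp: vec_eq_iff Bex_def in_set_conv_nth)
    moreover have "?A *\<^sub>v ?w = k \<cdot>\<^sub>v ?w \<longleftrightarrow> (\<forall>i < ?n. (?A *\<^sub>v ?w) $ i = k * f (xs ! i))"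
      using dims by (auto simp: vec_eq_iff simp del: index_mult_mat_vec)
    ultimately show ?thesis
      using dims by (simp add: eigenvector_def row all_set_conv_all_nth del: index_mult_mat_vec)
  qed
  have "\<exists>f. w = vec ?n (\<lambda>i. f (xs ! i))" if "w \<in> carrier_vec ?n" for w :: "real vec"
  proof
    show "w = vec ?n (\<lambda>i. (\<lambda>u. w $ the_inv_into {0..<?n} ((!) xs) u) (xs ! i))"
      using that bij by (auto simp: vec_eq_iff the_inv_into_f_f bij_betw_def)
  qed
  then show ?thesis
    unfolding eigenvalue_def eq[symmetric] using dims(1) by (metis eigenvector_def)
qed

lemma eigenvalue_adjacency_matrix_cong:
  assumes "distinct xs" "distinct ys" "set xs = set ys"
  shows "eigenvalue (adjacency_matrix xs G) = eigenvalue (adjacency_matrix ys G)"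
  using assms by (auto simp: fun_eq_iff eigenvalue_adjacency_matrix_iff)

end

theory Submission
  imports Defs "HOL-Analysis.Function_Topology"
begin

text \<open>
  The idea is to compare a maximal counterexample with a star. Suppose that \<open>G\<close>, of order
  \<open>n \<ge> 3\<close>, has no Hamiltonian cycle, and add edges as long as no Hamiltonian cycle arises. In the
  resulting graph \<open>H\<close>, nonadjacent vertices have degree sum less than \<open>n\<close> (\<open>bondy_chvatal\<close>), so
  in the complement of \<open>H\<close> adjacent vertices have degree sum at least \<open>n - 1 = m + 1\<close>, where
  \<open>m = n - 2\<close>. This complement has an edge, because complete graphs are Hamiltonian. For
  Hamiltonian paths the same holds with \<open>m = n - 1\<close>; this follows from the statement about cycles
  by joining a new vertex to all others.

  The complement of \<open>H\<close> is a subgraph of the complement of \<open>G\<close>, so its spectral radius is at most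
  \<open>sqrt m\<close> as well. Large degree sums along edges make the sum of the squares of the degrees
  large, and a small spectral radius makes it small. Together they leave room for \<open>m\<close> edges at
  most, while the edges meeting any fixed edge already number at least \<open>m\<close>. Hence any two edges
  intersect, so they form a star or a triangle, and the spectral radius of a triangle is too large
  (\<open>star_of_degree_sums\<close>). So the complement of \<open>H\<close> is a star with \<open>m\<close> leaves. The spectral radius
  of this star is exactly \<open>sqrt m\<close>, and any additional edge would increase it
  (\<open>eq_star_of_star_subset\<close>); so the complement of \<open>G\<close> is the same star. A star with \<open>n - 1\<close>
  leaves is the complement of a complete graph with an isolated vertex, and a star with \<open>n - 2\<close>
  leaves together with an isolated vertex is the complement of a complete graph with a pendent
  edge.

  All spectral arguments use the spectral radius only through the inequality
  \<open>rayleigh_le_spectral_radius\<close> for the quadratic form of the adjacency matrix.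
\<close>

section \<open>Finite simple graphs as relations\<close>

locale simple_graph =
  fixes V :: "'a set" and R :: "'a rel"
  assumes finite_verts: "finite V"
    and arcs_subset: "R \<subseteq> V \<times> V"
    and sym_arcs: "sym R"
    and irrefl_arcs: "irrefl R"
begin

lemma finite_arcs: "finite R"
  using finite_subset[OF arcs_subset] finite_verts by simp

lemma finite_neighbours: "finite (R `` {u})"
  using finite_arcs by auto

lemma arc_sym: "(u, v) \<in> R \<Longrightarrow> (v, u) \<in> R"
  using sym_arcs by (auto dest: symD)

lemma arc_neq: "(u, v) \<in> R \<Longrightarrow> u \<noteq> v"
  using irrefl_arcs by (auto simp: irrefl_def)

lemma arc_verts: "(u, v) \<in> R \<Longrightarrow> u \<in> V" "(u, v) \<in> R \<Longrightarrow> v \<in> V"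
  using arcs_subset by auto

lemma sum_arcs: "(\<Sum>(u, v)\<in>R. h u v) = (\<Sum>u\<in>V. \<Sum>v\<in>R `` {u}. h u v)"
proof -
  have "R = Sigma V (\<lambda>u. R `` {u})"
    using arcs_subset by auto
  then show ?thesis
    using sum.Sigma[OF finite_verts, of "\<lambda>u. R `` {u}" h] finite_neighbours by simp
qed

lemma sum_arcs_swap: "(\<Sum>(u, v)\<in>R. h u v) = (\<Sum>(u, v)\<in>R. h v u)"
  by (rule sum.reindex_bij_witness[of _ "\<lambda>(u, v). (v, u)" "\<lambda>(u, v). (v, u)"])
    (auto intro: arc_sym)

end

section \<open>Rayleigh quotients and the spectral radius\<close>

text \<open>
  The bilinear form \<open>f\<^sup>T A g\<close> of the adjacency matrix \<open>A\<close>. As a sum over arcs it needs no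
  enumeration of the vertices and it is visibly monotone in the arc set for nonnegative \<open>f\<close>.
\<close>

definition adj_form :: "'a rel \<Rightarrow> ('a \<Rightarrow> real) \<Rightarrow> ('a \<Rightarrow> real) \<Rightarrow> real" where
  "adj_form R f g = (\<Sum>(u, v)\<in>R. f u * g v)"

context simple_graph
begin

lemma adj_form_eq: "adj_form R f g = (\<Sum>u\<in>V. f u * (\<Sum>v\<in>R `` {u}. g v))"
  unfolding adj_form_def sum_arcs by (simp add: sum_distrib_left)

lemma adj_form_commute: "adj_form R f g = adj_form R g f"
  using sum_arcs_swap[of "\<lambda>u v. f u * g v"] by (simp add: adj_form_def mult.commute)

lemma adj_form_perturb:
  "adj_form R (\<lambda>u. f u + t * g u) (\<lambda>u. f u + t * g u)
     = adj_form R f f + 2 * t * adj_form R g f + t\<^sup>2 * adj_form R g g"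
proof -
  have "adj_form R (\<lambda>u. f u + t * g u) (\<lambda>u. f u + t * g u)
     = adj_form R f f + t * adj_form R g f + t * adj_form R f g + t\<^sup>2 * adj_form R g g"
    unfolding adj_form_def
    by (simp add: sum.distrib[symmetric] sum_distrib_left case_prod_unfold)
      (rule sum.cong, auto simp: algebra_simps power2_eq_square)
  then show ?thesis
    using adj_form_commute[of f g] by simp
qed

text \<open>
  A first-order condition. With \<open>g = A x - s x\<close>, moving from \<open>x\<close> to \<open>x + t g\<close> changes
  \<open>f\<^sup>T A f - s |f|\<^sup>2\<close> by \<open>2 t |g|\<^sup>2 - c t\<^sup>2\<close> for a constant \<open>c\<close>, which would be
  positive for small \<open>t > 0\<close> unless \<open>g\<close> vanishes. The lemma is used twice: for the existence of
  an eigenvector here, and for the rigidity of stars in \<open>eq_star_of_star_subset\<close>.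
\<close>

lemma maximiser_is_eigenvector:
  assumes bound: "\<And>f. adj_form R f f \<le> s * (\<Sum>u\<in>V. (f u)\<^sup>2)"
    and attained: "adj_form R x x \<ge> s * (\<Sum>u\<in>V. (x u)\<^sup>2)"
    and "u \<in> V"
  shows "(\<Sum>v\<in>R `` {u}. x v) = s * x u"
proof -
  define g where "g u = (\<Sum>v\<in>R `` {u}. x v) - s * x u" for u
  define b where "b = (\<Sum>u\<in>V. (g u)\<^sup>2)"
  define c where "c = s * b - adj_form R g g"
  have c: "c \<ge> 0"
    using bound[of g] by (simp add: c_def b_def)
  have b: "b = adj_form R g x - s * (\<Sum>u\<in>V. g u * x u)"
  proof -
    have "b = (\<Sum>u\<in>V. g u * ((\<Sum>v\<in>R `` {u}. x v) - s * x u))"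
      by (simp add: b_def g_def power2_eq_square)
    also have "\<dots> = adj_form R g x - s * (\<Sum>u\<in>V. g u * x u)"
      by (simp add: adj_form_eq right_diff_distrib sum_subtractf mult.left_commute
        sum_distrib_left[where r = s])
    finally show ?thesis .
  qed
  have key: "2 * t * b \<le> t\<^sup>2 * c" for t
  proof -
    have "(\<Sum>u\<in>V. (x u + t * g u)\<^sup>2)
        = (\<Sum>u\<in>V. (x u)\<^sup>2) + 2 * t * (\<Sum>u\<in>V. g u * x u) + t\<^sup>2 * b"
      unfolding b_def
      by (simp add: sum.distrib[symmetric] sum_distrib_left)
        (rule sum.cong, auto simp: algebra_simps power2_eq_square)
    moreover have "2 * t * b = 2 * t * adj_form R g x - s * (2 * t * (\<Sum>u\<in>V. g u * x u))"
      unfolding b by (simp add: algebra_simps)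
    ultimately show ?thesis
      using bound[of "\<lambda>u. x u + t * g u"] attained
      unfolding adj_form_perturb c_def by (simp add: distrib_left right_diff_distrib mult.left_commute)
  qed
  have "b = 0"
  proof (rule ccontr)
    assume "b \<noteq> 0"
    then have "b > 0" unfolding b_def
      by (simp add: less_le sum_nonneg)
    \<comment> \<open>Any step with \<open>0 < t\<close> and \<open>t * c < 2 * b\<close> contradicts \<open>key\<close>.\<close>
    define t where "t = b / (c + 1)"
    have t: "t > 0" "t * (c + 1) = b"
      using \<open>b > 0\<close> c by (simp_all add: t_def)
    have "t * (2 * b) \<le> t * (t * c)"
      using key[of t] by (simp add: power2_eq_square ac_simps)
    then have "2 * b \<le> t * c"
      using t(1) by simp
    also have "\<dots> \<le> b"
      using t by (simp add: distrib_left)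
    finally show False
      using \<open>b > 0\<close> by simp
  qed
  then have "g u = 0"
    using \<open>u \<in> V\<close> finite_verts by (simp add: b_def sum_nonneg_eq_0_iff)
  then show ?thesis by (simp add: g_def)
qed

text \<open>
  The quadratic form attains its maximum on the unit sphere. The vectors are functions on the whole
  type, so the sphere is made compact by requiring them to vanish outside \<open>V\<close>: it is then a closed
  subset of a product of compact intervals and singletons.
\<close>

lemma rayleigh_maximum:
  assumes "V \<noteq> {}"
  obtains s x where "\<exists>u\<in>V. x u \<noteq> 0" "\<forall>u\<in>V. (\<Sum>v\<in>R `` {u}. x v) = s * x u"
    "\<And>f. adj_form R f f \<le> s * (\<Sum>u\<in>V. (f u)\<^sup>2)"
proof -
  define B where "B = PiE UNIV (\<lambda>u. if u \<in> V then {-1..1::real} else {0})"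
  define S where "S = B \<inter> {f. (\<Sum>u\<in>V. (f u)\<^sup>2) = 1}"
  have coord: "continuous_on UNIV (\<lambda>f :: 'a \<Rightarrow> real. f u)" for u
    by simp
  have "compactin (product_topology (\<lambda>_. euclidean) UNIV) B"
    unfolding B_def by (subst compactin_PiE) auto
  then have "compact B"
    by (simp add: euclidean_product_topology)
  moreover have "closed {f :: 'a \<Rightarrow> real. (\<Sum>u\<in>V. (f u)\<^sup>2) = 1}"
    by (intro closed_Collect_eq continuous_intros coord)
  ultimately have "compact S"
    unfolding S_def by blast
  have in_S: "f \<in> S" if "\<And>u. u \<notin> V \<Longrightarrow> f u = 0" "(\<Sum>u\<in>V. (f u)\<^sup>2) = 1" for f
  proof -
    have "(f u)\<^sup>2 \<le> 1" if "u \<in> V" for u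
      using member_le_sum[of u V "\<lambda>u. (f u)\<^sup>2"] that finite_verts \<open>(\<Sum>u\<in>V. (f u)\<^sup>2) = 1\<close> by simp
    then have "f u \<in> {-1..1}" if "u \<in> V" for u
      using that by (simp add: abs_square_le_1 abs_le_iff)
    then show ?thesis
      using that by (simp add: S_def B_def PiE_def Pi_def)
  qed
  from assms obtain a where "a \<in> V" by blast
  have "(\<Sum>u\<in>V. (if u = a then 1 else 0 :: real)\<^sup>2) = 1"
    using \<open>a \<in> V\<close> finite_verts by (simp add: if_distrib[of "\<lambda>z. z\<^sup>2"] cong: if_cong)
  then have "(\<lambda>u. if u = a then 1 else 0) \<in> S"
    using \<open>a \<in> V\<close> by (intro in_S) auto
  then have "S \<noteq> {}" by blast
  have "continuous_on S (\<lambda>f. f u)" for u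
    using coord by (rule continuous_on_subset) simp
  then have "continuous_on S (\<lambda>f. adj_form R f f)"
    unfolding adj_form_def case_prod_unfold by (intro continuous_on_sum continuous_on_mult)
  from continuous_attains_sup[OF \<open>compact S\<close> \<open>S \<noteq> {}\<close> this]
  obtain x where x: "x \<in> S" and max: "\<And>f. f \<in> S \<Longrightarrow> adj_form R f f \<le> adj_form R x x"
    by blast
  define s where "s = adj_form R x x"
  have bound: "adj_form R f f \<le> s * (\<Sum>u\<in>V. (f u)\<^sup>2)" for f
  proof (cases "(\<Sum>u\<in>V. (f u)\<^sup>2) = 0")
    case True
    then have "f u = 0" if "u \<in> V" for u
      using that finite_verts by (simp add: sum_nonneg_eq_0_iff)
    then show ?thesis
      unfolding adj_form_eq True by simp
  next
    case False
    define N where "N = (\<Sum>u\<in>V. (f u)\<^sup>2)"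
    have "N > 0"
      using False by (simp add: N_def less_le sum_nonneg)
    define g where "g u = (if u \<in> V then f u / sqrt N else 0)" for u
    have "(\<Sum>u\<in>V. (g u)\<^sup>2) = 1"
      using \<open>N > 0\<close> by (simp add: g_def power_divide sum_divide_distrib[symmetric] N_def[symmetric])
    then have "adj_form R g g \<le> s"
      unfolding s_def by (intro max in_S) (auto simp: g_def)
    moreover have "adj_form R g g = adj_form R f f / N"
    proof -
      have "adj_form R g g = (\<Sum>(u, v)\<in>R. f u * f v / N)"
        unfolding adj_form_def
        using \<open>N > 0\<close> by (auto intro!: sum.cong simp: g_def dest: arc_verts)
      then show ?thesis
        by (simp add: adj_form_def sum_divide_distrib case_prod_unfold)
    qed
    ultimately show ?thesis
      using \<open>N > 0\<close> by (simp add: N_def[symmetric] field_simps)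
  qed
  have norm: "(\<Sum>u\<in>V. (x u)\<^sup>2) = 1"
    using x by (simp add: S_def)
  have "\<exists>u\<in>V. x u \<noteq> 0"
  proof (rule ccontr)
    assume "\<not> ?thesis"
    with norm show False by simp
  qed
  moreover have "\<forall>u\<in>V. (\<Sum>v\<in>R `` {u}. x v) = s * x u"
    using maximiser_is_eigenvector[OF bound, of x] norm by (simp add: s_def)
  ultimately show thesis
    using bound by (rule that)
qed

end

text \<open>
  The spectral radius is the largest eigenvalue, and the maximum of the Rayleigh quotient is an
  eigenvalue. Finiteness of the spectrum is what makes \<^const>\<open>Max\<close> meaningful; it comes from the
  characteristic polynomial.
\<close>

lemma rayleigh_le_spectral_radius:
  assumes "simple_graph (pverts G) (parcs G)"
  shows "adj_form (parcs G) f f \<le> graph_spectral_radius G * (\<Sum>u\<in>pverts G. (f u)\<^sup>2)"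
proof (cases "pverts G = {}")
  case True
  then show ?thesis
    using simple_graph.adj_form_eq[OF assms, of f f] by simp
next
  case False
  interpret simple_graph "pverts G" "parcs G" by fact
  obtain s x where x: "\<exists>u\<in>pverts G. x u \<noteq> 0"
      "\<forall>u\<in>pverts G. (\<Sum>v\<in>parcs G `` {u}. x v) = s * x u"
    and bound: "\<And>f. adj_form (parcs G) f f \<le> s * (\<Sum>u\<in>pverts G. (f u)\<^sup>2)"
    by (rule rayleigh_maximum[OF False]) (rule that)
  define xs where "xs = vertex_enumeration G"
  define A where "A = adjacency_matrix xs G"
  have xs: "distinct xs" "set xs = pverts G"
    using vertex_enumeration[OF finite_verts] by (simp_all add: xs_def)
  have "{v. v \<in> pverts G \<and> (u, v) \<in> parcs G} = parcs G `` {u}" for u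
    using arc_verts by auto
  with x have "eigenvalue A s"
    unfolding A_def eigenvalue_adjacency_matrix_iff[OF xs(1)] xs(2) by auto
  moreover have "finite {k. eigenvalue A k}"
  proof -
    have A: "A \<in> carrier_mat (length xs) (length xs)"
      by (simp add: A_def adjacency_matrix_def)
    then have "char_poly A \<noteq> 0"
      using degree_monic_char_poly[OF A] by auto
    then show ?thesis
      by (simp add: eigenvalue_root_char_poly[OF A] poly_roots_finite)
  qed
  ultimately have "s \<le> graph_spectral_radius G"
    unfolding graph_spectral_radius_def xs_def[symmetric] A_def[symmetric] by simp
  then show ?thesis
    using bound[of f] mult_right_mono[of s "graph_spectral_radius G" "\<Sum>u\<in>pverts G. (f u)\<^sup>2"]
    by (simp add: sum_nonneg)
qed

section \<open>Spanning paths and cycles as vertex lists\<close>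

definition ham_path :: "'a set \<Rightarrow> 'a rel \<Rightarrow> 'a list \<Rightarrow> bool" where
  "ham_path V R xs \<longleftrightarrow> distinct xs \<and> set xs = V \<and> successively (\<lambda>u v. (u, v) \<in> R) xs"

definition ham_cycle :: "'a set \<Rightarrow> 'a rel \<Rightarrow> 'a list \<Rightarrow> bool" where
  "ham_cycle V R xs \<longleftrightarrow> ham_path V R xs \<and> 3 \<le> length xs \<and> (last xs, hd xs) \<in> R"

lemma ham_cycle_rotate: "ham_cycle V R (xs @ ys) \<Longrightarrow> ham_cycle V R (ys @ xs)"
  by (cases "xs = []"; cases "ys = []")
    (auto simp: ham_cycle_def ham_path_def successively_append_iff)

lemma not_successivelyE:
  assumes "\<not> successively P xs"
  obtains as a b bs where "xs = as @ a # b # bs" "\<not> P a b"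
proof -
  have "\<exists>as a b bs. xs = as @ a # b # bs \<and> \<not> P a b"
    using assms
  proof (induction P xs rule: successively.induct)
    case (3 P x y xs)
    show ?case
    proof (cases "P x y")
      case True
      with 3 obtain as a b bs where "y # xs = as @ a # b # bs" "\<not> P a b" by auto
      then show ?thesis by (metis append_Cons)
    next
      case False
      then show ?thesis by (metis append_Nil)
    qed
  qed auto
  then show thesis using that by blast
qed

text \<open>
  Ore's crossing argument. Let the path be \<open>x\<^sub>0, \<dots>, x\<^sub>k\<close>. Among its \<open>card V - 1\<close> steps, those
  whose second vertex is adjacent to \<open>x\<^sub>0\<close> and those whose first vertex is adjacent to \<open>x\<^sub>k\<close> are
  too many to be disjoint. At a common step \<open>(x\<^sub>i, x\<^sub>i\<^sub>+\<^sub>1)\<close> the path is cut, and the reversed second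
  half is attached to the first half.
\<close>

lemma (in simple_graph) ham_cycle_of_ham_path:
  assumes path: "ham_path V R xs" and len: "3 \<le> length xs"
    and deg: "card V \<le> card (R `` {hd xs}) + card (R `` {last xs})"
  shows "\<exists>ys. ham_cycle V R ys"
proof -
  define n where "n = length xs"
  define I where "I = {i. i < n - 1 \<and> (hd xs, xs ! Suc i) \<in> R}"
  define J where "J = {i. i < n - 1 \<and> (last xs, xs ! i) \<in> R}"
  have dist: "distinct xs" and set: "set xs = V"
    and succ: "successively (\<lambda>u v. (u, v) \<in> R) xs"
    using path by (auto simp: ham_path_def)
  have n: "n \<ge> 3" "card V = n" "xs \<noteq> []"
    using len dist set by (auto simp: n_def distinct_card[symmetric])
  have hd: "hd xs = xs ! 0" and last: "last xs = xs ! (n - 1)"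
    using n by (auto simp: hd_conv_nth last_conv_nth n_def)
  have "R `` {hd xs} \<subseteq> (\<lambda>i. xs ! Suc i) ` I"
  proof
    fix v assume "v \<in> R `` {hd xs}"
    then have v: "(hd xs, v) \<in> R" by simp
    then obtain i where i: "i < n" "v = xs ! i"
      using arc_verts(2) set by (metis in_set_conv_nth n_def)
    with v hd have "i \<noteq> 0" using arc_neq by metis
    with i v have "i - 1 \<in> I" "v = xs ! Suc (i - 1)"
      by (auto simp: I_def)
    then show "v \<in> (\<lambda>i. xs ! Suc i) ` I" by blast
  qed
  then have cI: "card (R `` {hd xs}) \<le> card I"
    by (rule surj_card_le[rotated]) (simp add: I_def)
  have "R `` {last xs} \<subseteq> (\<lambda>i. xs ! i) ` J"
  proof
    fix v assume "v \<in> R `` {last xs}"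
    then have v: "(last xs, v) \<in> R" by simp
    then obtain i where i: "i < n" "v = xs ! i"
      using arc_verts(2) set by (metis in_set_conv_nth n_def)
    with v last have "i \<noteq> n - 1" using arc_neq by metis
    with i v have "i \<in> J"
      by (auto simp: J_def)
    with i show "v \<in> (\<lambda>i. xs ! i) ` J" by blast
  qed
  then have cJ: "card (R `` {last xs}) \<le> card J"
    by (rule surj_card_le[rotated]) (simp add: J_def)
  have "I \<inter> J \<noteq> {}"
  proof
    assume "I \<inter> J = {}"
    then have "card I + card J = card (I \<union> J)"
      by (subst card_Un_disjoint) (auto simp: I_def J_def)
    also have "\<dots> \<le> card {..<n - 1}"
      by (rule card_mono) (auto simp: I_def J_def)
    finally show False
      using cI cJ deg n by simp
  qed
  then obtain i where i: "i < n - 1" "(hd xs, xs ! Suc i) \<in> R" "(last xs, xs ! i) \<in> R"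
    by (auto simp: I_def J_def)
  define as where "as = take (Suc i) xs"
  define bs where "bs = drop (Suc i) xs"
  have xs: "xs = as @ bs" and ne: "as \<noteq> []" "bs \<noteq> []"
    using i n by (auto simp: as_def bs_def n_def)
  have "hd as = hd xs" "last bs = last xs"
    using ne by (simp_all add: xs)
  moreover have "last as = xs ! i" "hd bs = xs ! Suc i"
    using i ne by (auto simp: as_def bs_def n_def hd_drop_conv_nth last_conv_nth min_def)
  ultimately have ends: "hd as = hd xs" "last as = xs ! i" "hd bs = xs ! Suc i" "last bs = last xs"
    by blast+
  have "successively (\<lambda>u v. (u, v) \<in> R) as" and "successively (\<lambda>u v. (u, v) \<in> R) bs"
    using succ unfolding xs successively_append_iff by blast+
  moreover from this have "successively (\<lambda>u v. (v, u) \<in> R) bs"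
    by (elim successively_mono) (rule arc_sym)
  moreover have "(last as, last bs) \<in> R" "(hd bs, hd as) \<in> R"
    unfolding ends by (rule arc_sym, fact i(3), rule arc_sym, fact i(2))
  moreover have "distinct as" "distinct bs" "set as \<inter> set bs = {}" "set as \<union> set bs = V"
    "3 \<le> length as + length bs"
    using dist set len unfolding xs by auto
  ultimately have "ham_cycle V R (as @ rev bs)"
    using ne unfolding ham_cycle_def ham_path_def
    by (simp add: successively_append_iff last_rev hd_rev)
  then show ?thesis by blast
qed

text \<open>
  Rotating a Hamiltonian cycle that uses the new edge \<open>uv\<close> so that this edge closes the cycle
  leaves a Hamiltonian path of the old graph with ends \<open>u\<close> and \<open>v\<close>.
\<close>

lemma (in simple_graph) bondy_chvatal:
  assumes cycle: "ham_cycle V (R \<union> {(u, v), (v, u)}) xs"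
    and deg: "card V \<le> card (R `` {u}) + card (R `` {v})"
  shows "\<exists>ys. ham_cycle V R ys"
proof (cases "ham_cycle V R xs")
  case False
  have len: "3 \<le> length xs"
    using cycle by (simp add: ham_cycle_def)
  obtain ys where ys: "ham_cycle V (R \<union> {(u, v), (v, u)}) ys" "(last ys, hd ys) \<notin> R"
  proof (cases "successively (\<lambda>u v. (u, v) \<in> R) xs")
    case True
    with False cycle have "(last xs, hd xs) \<notin> R"
      by (auto simp: ham_cycle_def ham_path_def)
    with cycle that show ?thesis by blast
  next
    case False
    then obtain as a b bs where "xs = as @ a # b # bs" "(a, b) \<notin> R"
      by (rule not_successivelyE)
    then show ?thesis
      using ham_cycle_rotate[of V _ "as @ [a]" "b # bs"] cycle that[of "(b # bs) @ (as @ [a])"]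
      by simp
  qed
  then have ends: "{last ys, hd ys} = {u, v}"
    by (auto simp: ham_cycle_def)
  have len': "3 \<le> length ys" and dist: "distinct ys"
    using ys by (auto simp: ham_cycle_def ham_path_def)
  \<comment> \<open>Among at least three distinct vertices, the two ends of the list are not consecutive.\<close>
  have "successively (\<lambda>u v. (u, v) \<in> R) ys"
  proof (rule ccontr)
    assume "\<not> ?thesis"
    then obtain as a b bs where s: "ys = as @ a # b # bs" "(a, b) \<notin> R"
      by (rule not_successivelyE)
    with ys(1) have "{a, b} = {u, v}"
      by (auto simp: ham_cycle_def ham_path_def successively_append_iff)
    with ends have *: "{a, b} = {last ys, hd ys}" by simp
    have "as = [] \<and> bs = []"
    proof (rule ccontr)
      assume "\<not> ?thesis"
      then have "hd ys \<notin> {a, b} \<or> last ys \<notin> {a, b}"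
        using dist unfolding s(1) by (cases as; cases bs rule: rev_cases) auto
      with * show False by auto
    qed
    with s len' show False by simp
  qed
  with ys have "ham_path V R ys"
    by (auto simp: ham_cycle_def ham_path_def)
  moreover have "card V \<le> card (R `` {hd ys}) + card (R `` {last ys})"
    using ends deg by (auto simp: doubleton_eq_iff)
  ultimately show ?thesis
    using ham_cycle_of_ham_path len' by blast
qed blast

text \<open>
  The graph with one extra vertex \<^const>\<open>None\<close> joined to everything: its Hamiltonian cycles are the
  Hamiltonian paths of the original graph, closed up through \<^const>\<open>None\<close>. This reduces statements
  about paths to statements about cycles; degrees and order grow by one.
\<close>

definition cone :: "'a set \<Rightarrow> 'a rel \<Rightarrow> 'a option rel" where
  "cone V R = map_prod Some Some ` R \<union> {None} \<times> Some ` V \<union> Some ` V \<times> {None}"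

lemma cone_simps [simp]:
  "(Some u, Some v) \<in> cone V R \<longleftrightarrow> (u, v) \<in> R"
  "(None, Some v) \<in> cone V R \<longleftrightarrow> v \<in> V"
  "(Some u, None) \<in> cone V R \<longleftrightarrow> u \<in> V"
  "(None, None) \<notin> cone V R"
  by (auto simp: cone_def)

lemma (in simple_graph) simple_graph_cone: "simple_graph (insert None (Some ` V)) (cone V R)"
proof
  show "finite (insert None (Some ` V))"
    using finite_verts by simp
  show "cone V R \<subseteq> insert None (Some ` V) \<times> insert None (Some ` V)"
    using arcs_subset by (auto simp: cone_def)
  show "sym (cone V R)"
    using sym_arcs by (auto simp: cone_def sym_def)
  show "irrefl (cone V R)"
    using arc_neq by (auto simp: cone_def irrefl_def)
qed

lemma (in simple_graph) card_cone_neighbours: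
  assumes "u \<in> V"
  shows "card (cone V R `` {Some u}) = Suc (card (R `` {u}))"
proof -
  have "cone V R `` {Some u} = insert None (Some ` (R `` {u}))"
    using assms by (auto simp: cone_def)
  then show ?thesis
    using finite_neighbours by (simp add: card_image)
qed

lemma ham_cycle_cone:
  assumes "ham_path V R xs" "2 \<le> card V"
  shows "ham_cycle (insert None (Some ` V)) (cone V R) (None # map Some xs)"
proof -
  have "length xs = card V"
    using assms by (auto simp: ham_path_def distinct_card)
  moreover have "successively (\<lambda>u v. (u, v) \<in> cone V R) (None # map Some xs)"
    using assms by (cases xs) (auto simp: ham_path_def successively_Cons successively_map hd_map)
  moreover have "xs \<noteq> []"
    using calculation assms by auto
  ultimately show ?thesis
    using assms by (auto simp: ham_cycle_def ham_path_def distinct_map last_map)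
qed

lemma ham_path_of_cone:
  assumes "ham_cycle (insert None (Some ` V)) (cone V R) xs"
  shows "\<exists>ys. ham_path V R ys"
proof -
  from assms have "None \<in> set xs"
    by (auto simp: ham_cycle_def ham_path_def)
  then obtain as bs where xs: "xs = as @ None # bs"
    by (meson split_list)
  define zs where "zs = bs @ as"
  have zs: "ham_cycle (insert None (Some ` V)) (cone V R) (None # zs)"
    using ham_cycle_rotate[of _ _ as "None # bs"] assms xs by (simp add: zs_def)
  then have "None \<notin> set zs" "insert None (set zs) = insert None (Some ` V)"
    by (auto simp: ham_cycle_def ham_path_def)
  then have set: "set zs = Some ` V" by (metis Diff_insert_absorb image_iff option.distinct(1))
  define ys where "ys = map the zs"
  have "zs = map Some ys"
    unfolding ys_def map_map by (rule map_idI[symmetric]) (use set in auto)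
  with zs set have "ham_path V R ys"
    by (auto simp: ham_cycle_def ham_path_def successively_Cons successively_map distinct_map inj_image_eq_iff)
  then show ?thesis by blast
qed

text \<open>
  Edge-maximal counterexamples. They play the role of the Bondy-Chvatal closure without the need
  to iterate the addition of edges.
\<close>

lemma ex_maximal_simple_supergraph:
  assumes "simple_graph V R" "P R"
  obtains H where "R \<subseteq> H" "simple_graph V H" "P H"
    "\<And>u v. u \<in> V \<Longrightarrow> v \<in> V \<Longrightarrow> u \<noteq> v \<Longrightarrow> (u, v) \<notin> H \<Longrightarrow> \<not> P (H \<union> {(u, v), (v, u)})"
proof -
  let ?\<H> = "{H. simple_graph V H \<and> P H}"
  have "?\<H> \<subseteq> Pow (V \<times> V)"
    by (auto simp: simple_graph_def)
  moreover have "finite V"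
    using assms by (simp add: simple_graph_def)
  ultimately have "finite ?\<H>"
    by (simp add: finite_subset)
  from finite_has_maximal2[OF this, of R] assms
  obtain H where H: "R \<subseteq> H" "simple_graph V H" "P H"
    and max: "\<And>H'. simple_graph V H' \<Longrightarrow> P H' \<Longrightarrow> H \<subseteq> H' \<Longrightarrow> H = H'"
    by auto
  have "\<not> P (H \<union> {(u, v), (v, u)})" if "u \<in> V" "v \<in> V" "u \<noteq> v" "(u, v) \<notin> H" for u v
  proof
    assume "P (H \<union> {(u, v), (v, u)})"
    moreover have "simple_graph V (H \<union> {(u, v), (v, u)})"
      using H(2) that by (auto simp: simple_graph_def sym_def irrefl_def)
    ultimately show False
      using max that by blast
  qed
  with H that show thesis by blast
qed

lemma maximal_supergraph_without_ham_cycle: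
  assumes "simple_graph V R" "\<nexists>xs. ham_cycle V R xs"
  obtains H where "R \<subseteq> H" "simple_graph V H" "\<nexists>xs. ham_cycle V H xs"
    "\<And>u v. u \<in> V \<Longrightarrow> v \<in> V \<Longrightarrow> u \<noteq> v \<Longrightarrow> (u, v) \<notin> H \<Longrightarrow> card (H `` {u}) + card (H `` {v}) < card V"
  using ex_maximal_simple_supergraph[of V R "\<lambda>H. \<nexists>xs. ham_cycle V H xs"] assms
  by (metis simple_graph.bondy_chvatal not_less)

text \<open>
  In the cone the degree sum of \<open>u\<close> and \<open>v\<close> is larger by 2 and the order by 1, so the threshold
  for paths is one lower than the one for cycles.
\<close>

lemma maximal_supergraph_without_ham_path:
  assumes "simple_graph V R" "\<nexists>xs. ham_path V R xs" "2 \<le> card V"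
  obtains H where "R \<subseteq> H" "simple_graph V H" "\<nexists>xs. ham_path V H xs"
    "\<And>u v. u \<in> V \<Longrightarrow> v \<in> V \<Longrightarrow> u \<noteq> v \<Longrightarrow> (u, v) \<notin> H \<Longrightarrow>
      card (H `` {u}) + card (H `` {v}) + 1 < card V"
proof -
  obtain H where H: "R \<subseteq> H" "simple_graph V H" "\<nexists>xs. ham_path V H xs"
    and max: "\<And>u v. u \<in> V \<Longrightarrow> v \<in> V \<Longrightarrow> u \<noteq> v \<Longrightarrow> (u, v) \<notin> H \<Longrightarrow>
      \<exists>xs. ham_path V (H \<union> {(u, v), (v, u)}) xs"
    using ex_maximal_simple_supergraph[of V R "\<lambda>H. \<nexists>xs. ham_path V H xs"] assms(1,2) by auto
  interpret H: simple_graph V H by fact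
  interpret cone: simple_graph "insert None (Some ` V)" "cone V H"
    by (rule H.simple_graph_cone)
  have "card (H `` {u}) + card (H `` {v}) + 1 < card V"
    if uv: "u \<in> V" "v \<in> V" "u \<noteq> v" "(u, v) \<notin> H" for u v
  proof (rule ccontr)
    assume deg: "\<not> ?thesis"
    obtain xs where "ham_path V (H \<union> {(u, v), (v, u)}) xs"
      using max uv by blast
    from ham_cycle_cone[OF this assms(3)]
    have "ham_cycle (insert None (Some ` V))
        (cone V H \<union> {(Some u, Some v), (Some v, Some u)}) (None # map Some xs)"
      by (simp add: cone_def Un_ac image_Un insert_commute)
    moreover have "card (insert None (Some ` V)) = Suc (card V)"
      using H.finite_verts by (simp add: card_image)
    then have "card (insert None (Some ` V))
        \<le> card (cone V H `` {Some u}) + card (cone V H `` {Some v})"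
      using deg uv by (simp add: H.card_cone_neighbours)
    ultimately show False
      using cone.bondy_chvatal ham_path_of_cone H(3) by blast
  qed
  with H that show thesis by blast
qed

section \<open>Graphs with large degree sums and small Rayleigh quotient\<close>

context simple_graph
begin

lemma adj_form_le_abs: "- adj_form R f f \<le> adj_form R (\<lambda>u. \<bar>f u\<bar>) (\<lambda>u. \<bar>f u\<bar>)"
  unfolding adj_form_def sum_negf[symmetric]
  by (rule sum_mono) (auto simp: abs_mult[symmetric] minus_le_iff intro: order_trans[OF abs_ge_minus_self])

text \<open>
  The operator norm of \<open>A\<close> is at most \<open>s\<close> when its largest eigenvalue is: replacing \<open>f\<close> by
  \<open>|f|\<close> shows that \<open>- f\<^sup>T A f\<close> obeys the same bound as \<open>f\<^sup>T A f\<close>, and polarisation with \<open>f\<close> and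
  \<open>A f / s\<close> turns the two bounds into one for \<open>|A f|\<close>. For \<open>f = 1\<close> this is Hofmeister's
  inequality between the squares of the degrees and the spectral radius.
\<close>

lemma sum_neighbour_sums_squared_le:
  assumes bound: "\<And>f. adj_form R f f \<le> s * (\<Sum>u\<in>V. (f u)\<^sup>2)" and "s > 0"
  shows "(\<Sum>u\<in>V. (\<Sum>v\<in>R `` {u}. f v)\<^sup>2) \<le> s\<^sup>2 * (\<Sum>u\<in>V. (f u)\<^sup>2)"
proof -
  define g where "g u = (\<Sum>v\<in>R `` {u}. f v)" for u
  define F where "F = (\<Sum>u\<in>V. (f u)\<^sup>2)"
  define Y where "Y = (\<Sum>u\<in>V. (g u)\<^sup>2)"
  define t where "t = 1 / s"
  have Y: "adj_form R g f = Y"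
    unfolding adj_form_eq Y_def g_def power2_eq_square ..
  have "adj_form R f f + 2 * t * Y + t\<^sup>2 * adj_form R g g \<le> s * (\<Sum>u\<in>V. (f u + t * g u)\<^sup>2)"
    using bound[of "\<lambda>u. f u + t * g u"] unfolding adj_form_perturb Y .
  moreover have "- (adj_form R f f + 2 * (- t) * Y + (- t)\<^sup>2 * adj_form R g g)
      \<le> s * (\<Sum>u\<in>V. (f u + (- t) * g u)\<^sup>2)"
    using adj_form_le_abs[of "\<lambda>u. f u + (- t) * g u"] bound[of "\<lambda>u. \<bar>f u + (- t) * g u\<bar>"]
    unfolding adj_form_perturb Y by simp
  ultimately have "4 * t * Y
      \<le> s * ((\<Sum>u\<in>V. (f u + t * g u)\<^sup>2) + (\<Sum>u\<in>V. (f u + (- t) * g u)\<^sup>2))"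
    by (simp add: distrib_left)
  \<comment> \<open>The parallelogram law.\<close>
  also have "(\<Sum>u\<in>V. (f u + t * g u)\<^sup>2) + (\<Sum>u\<in>V. (f u + (- t) * g u)\<^sup>2) = 2 * (F + t\<^sup>2 * Y)"
    unfolding F_def Y_def sum.distrib[symmetric] sum_distrib_left
    by (rule sum.cong) (auto simp: power2_eq_square algebra_simps)
  finally have "4 * t * Y \<le> s * (2 * (F + t\<^sup>2 * Y))" .
  then have "Y \<le> s\<^sup>2 * F"
    using \<open>s > 0\<close> by (simp add: t_def field_simps power2_eq_square)
  then show ?thesis
    by (simp add: Y_def F_def g_def)
qed

lemma sum_degree_squares:
  "2 * (\<Sum>u\<in>V. (card (R `` {u}))\<^sup>2) = (\<Sum>(u, v)\<in>R. card (R `` {u}) + card (R `` {v}))"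
proof -
  have "(\<Sum>u\<in>V. (card (R `` {u}))\<^sup>2) = (\<Sum>(u, v)\<in>R. card (R `` {u}))"
    by (simp add: sum_arcs power2_eq_square)
  moreover have "(\<Sum>(u, v)\<in>R. card (R `` {v})) = (\<Sum>(u, v)\<in>R. card (R `` {u}))"
    by (rule sum_arcs_swap)
  ultimately show ?thesis
    by (simp add: case_prod_unfold sum.distrib)
qed

text \<open>
  The arcs that leave \<open>a\<close> or \<open>b\<close> and the arcs that enter \<open>a\<close> or \<open>b\<close> overlap exactly in the two
  arcs between \<open>a\<close> and \<open>b\<close>.
\<close>

lemma card_arcs_meeting_edge:
  assumes "(a, b) \<in> R"
  shows "card {(x, y) \<in> R. {x, y} \<inter> {a, b} \<noteq> {}} + 2 = 2 * (card (R `` {a}) + card (R `` {b}))"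
proof -
  define Q where "Q = {a} \<times> R `` {a} \<union> {b} \<times> R `` {b}"
  have "a \<noteq> b" "(b, a) \<in> R"
    using assms arc_neq arc_sym by blast+
  have fin: "finite Q"
    using finite_neighbours by (simp add: Q_def)
  have "card Q = card (R `` {a}) + card (R `` {b})"
    unfolding Q_def using \<open>a \<noteq> b\<close> finite_neighbours
    by (subst card_Un_disjoint) (auto simp: card_cartesian_product)
  moreover have "Q \<inter> Q\<inverse> = {(a, b), (b, a)}"
    using assms \<open>(b, a) \<in> R\<close> arc_neq by (auto simp: Q_def)
  then have "card (Q \<inter> Q\<inverse>) = 2"
    using \<open>a \<noteq> b\<close> by simp
  moreover have "Q \<union> Q\<inverse> = {(x, y) \<in> R. {x, y} \<inter> {a, b} \<noteq> {}}"
    using arc_sym by (auto simp: Q_def)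
  ultimately show ?thesis
    using card_Un_Int[OF fin, of "Q\<inverse>"] fin by (simp add: card_inverse)
qed

end

definition star :: "'a \<Rightarrow> 'a set \<Rightarrow> 'a rel" where
  "star c L = {c} \<times> L \<union> L \<times> {c}"

lemma (in simple_graph) star_or_triangle:
  assumes "R \<noteq> {}" and intersecting: "\<forall>(a, b)\<in>R. \<forall>(x, y)\<in>R. {x, y} \<inter> {a, b} \<noteq> {}"
  obtains (star) c where "star c (R `` {c}) = R"
    | (triangle) a b c where "a \<noteq> b" "b \<noteq> c" "a \<noteq> c"
      "R = {(a, b), (b, a), (a, c), (c, a), (b, c), (c, b)}"
proof -
  have meet: "{x, y} \<inter> {a, b} \<noteq> {}" if "(a, b) \<in> R" "(x, y) \<in> R" for a b x y
    using that intersecting by blast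
  obtain a b where ab: "(a, b) \<in> R"
    using \<open>R \<noteq> {}\<close> by (metis ex_in_conv surj_pair)
  note ba = arc_sym[OF ab]
  have "a \<noteq> b" using ab arc_neq by blast
  have star: "star p (R `` {p}) = R" if "(p, q) \<in> R" "R `` {q} \<subseteq> {p}" for p q
    using meet[OF that(1)] that(2) arc_sym unfolding star_def by fast
  show thesis
  proof (cases "R `` {a} \<subseteq> {b} \<or> R `` {b} \<subseteq> {a}")
    case True
    then show thesis
      using that(1)[OF star[OF ab]] that(1)[OF star[OF ba]] by (elim disjE)
  next
    case False
    then obtain c x where cx: "(a, c) \<in> R" "c \<noteq> b" "(b, x) \<in> R" "x \<noteq> a"
      by auto
    have "a \<noteq> c" using cx arc_neq by blast
    have "x = c"
      using meet[OF cx(1) cx(3)] cx \<open>a \<noteq> b\<close> by auto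
    with cx have ac: "(a, c) \<in> R" and bc: "(b, c) \<in> R" by simp_all
    have "(p, q) \<in> {(a, b), (b, a), (a, c), (c, a), (b, c), (c, b)}" if "(p, q) \<in> R" for p q
      using meet[OF ab that] meet[OF ac that] meet[OF bc that] arc_neq[OF that]
        \<open>a \<noteq> b\<close> \<open>a \<noteq> c\<close> \<open>c \<noteq> b\<close> by auto
    then have "R \<subseteq> {(a, b), (b, a), (a, c), (c, a), (b, c), (c, b)}"
      by (rule subrelI)
    moreover have "{(a, b), (b, a), (a, c), (c, a), (b, c), (c, b)} \<subseteq> R"
      using ab ac bc arc_sym by blast
    ultimately have "R = {(a, b), (b, a), (a, c), (c, a), (b, c), (c, b)}"
      by (rule equalityI)
    then show thesis
      using that(2)[OF \<open>a \<noteq> b\<close> cx(2)[symmetric] \<open>a \<noteq> c\<close>] by simp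
  qed
qed

text \<open>
  Summing the hypothesis over all arcs gives \<open>(m + 1) * card R \<le> 2 * (\<Sum>u\<in>V. deg u ^ 2)\<close>, and
  Hofmeister's inequality bounds the right-hand side by \<open>2 * m * card V < 2 * (m + 1)\<^sup>2\<close>. So there
  are at most \<open>m\<close> edges, while every single edge meets at least \<open>m\<close> edges: all edges meet each
  other. A triangle would need \<open>m \<le> 3\<close> by the degree condition, but \<open>m \<ge> 4\<close> since its spectral
  radius is 2.
\<close>

lemma (in simple_graph) star_of_degree_sums:
  assumes ne: "R \<noteq> {}"
    and deg: "\<And>a b. (a, b) \<in> R \<Longrightarrow> m + 1 \<le> card (R `` {a}) + card (R `` {b})"
    and size: "card V * m < (m + 1)\<^sup>2"
    and bound: "\<And>f. adj_form R f f \<le> sqrt m * (\<Sum>u\<in>V. (f u)\<^sup>2)"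
  obtains c L where "c \<notin> L" "card L = m" "R = star c L"
proof -
  have "m > 0"
  proof (rule ccontr)
    assume "\<not> m > 0"
    then have "card R = 0"
      using bound[of "\<lambda>_. 1"] by (simp add: adj_form_def)
    with ne finite_arcs show False by simp
  qed
  have "(m + 1) * card R = (\<Sum>(u, v)\<in>R. m + 1)"
    by simp
  also have "\<dots> \<le> (\<Sum>(u, v)\<in>R. card (R `` {u}) + card (R `` {v}))"
    using deg by (intro sum_mono) auto
  also have "\<dots> = 2 * (\<Sum>u\<in>V. (card (R `` {u}))\<^sup>2)"
    by (rule sum_degree_squares[symmetric])
  also have "(\<Sum>u\<in>V. (card (R `` {u}))\<^sup>2) \<le> m * card V"
    using sum_neighbour_sums_squared_le[OF bound, of "\<lambda>_. 1"] \<open>m > 0\<close>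
    by (simp flip: of_nat_power of_nat_sum of_nat_mult)
  also have "2 * (m * card V) < (m + 1) * (2 * (m + 1))"
    using size by (simp add: power2_eq_square ac_simps)
  finally have few: "card R < 2 * (m + 1)"
    by (simp only: mult_less_cancel1)
  have meet: "{x, y} \<inter> {a, b} \<noteq> {}" if ab: "(a, b) \<in> R" and xy: "(x, y) \<in> R" for a b x y
  proof
    assume disj: "{x, y} \<inter> {a, b} = {}"
    let ?T = "{(x, y) \<in> R. {x, y} \<inter> {a, b} \<noteq> {}}"
    have "finite ?T"
      by (rule finite_subset[OF _ finite_arcs]) auto
    have "2 * (m + 1) \<le> 2 * (card (R `` {a}) + card (R `` {b}))"
      using deg[OF ab] by simp
    also have "\<dots> = card ?T + 2"
      by (rule card_arcs_meeting_edge[OF ab, symmetric])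
    also have "\<dots> = card (?T \<union> {(x, y), (y, x)})"
      using disj arc_neq[OF xy] \<open>finite ?T\<close> by (subst card_Un_disjoint) auto
    also have "\<dots> \<le> card R"
      using xy arc_sym finite_arcs by (intro card_mono) auto
    finally show False
      using few by simp
  qed
  have "\<forall>(a, b)\<in>R. \<forall>(x, y)\<in>R. {x, y} \<inter> {a, b} \<noteq> {}"
    using meet by blast
  with ne show thesis
  proof (cases rule: star_or_triangle)
    case (star c)
    let ?L = "R `` {c}"
    have c: "c \<notin> ?L"
      using arc_neq by blast
    have fin: "finite ?L"
      by (rule finite_neighbours)
    have "?L \<noteq> {}"
    proof
      assume "?L = {}"
      with star have "R = {}"
        by (simp add: star_def)
      with ne show False ..
    qed
    then obtain b where b: "(c, b) \<in> R"
      by blast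
    have "card (star c ?L) = 2 * card ?L"
      unfolding star_def using c fin by (subst card_Un_disjoint) (auto simp: card_cartesian_product)
    then have "card R = 2 * card ?L"
      using star by simp
    moreover have "star c ?L `` {b} = {c}"
      using b c by (auto simp: star_def)
    then have "R `` {b} = {c}"
      unfolding star .
    then have "m \<le> card ?L"
      using deg[OF b] by simp
    ultimately have "card ?L = m"
      using few by simp
    with c show thesis
      by (rule that) (rule star[symmetric])
  next
    case (triangle a b c)
    then have "R `` {a} = {b, c}" "R `` {b} = {a, c}"
      by auto
    then have "m + 1 \<le> 4"
      using deg[of a b] triangle by auto
    define f where "f u = (if u \<in> {a, b, c} then 1 else 0 :: real)" for u
    have "{a, b, c} \<subseteq> V"
      using arcs_subset triangle by auto
    then have "(\<Sum>u\<in>V. (f u)\<^sup>2) = (\<Sum>u\<in>{a, b, c}. (f u)\<^sup>2)"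
      using finite_verts by (intro sum.mono_neutral_right) (auto simp: f_def)
    also have "\<dots> = 3"
      using triangle by (simp add: f_def)
    finally have "(\<Sum>u\<in>V. (f u)\<^sup>2) = 3" .
    moreover have "adj_form R f f = 6"
      unfolding adj_form_def triangle(4) using triangle(1-3) by (simp add: f_def)
    ultimately have "2 \<le> sqrt m"
      using bound[of f] by simp
    then have "4 \<le> real m"
      using real_le_rsqrt real_sqrt_le_iff[of 4 m] by simp
    with \<open>m + 1 \<le> 4\<close> show thesis by simp
  qed
qed

text \<open>
  The Perron vector \<open>x\<close> of the star (\<open>sqrt m\<close> at the centre, 1 at the leaves) already attains the
  bound, so it is an eigenvector of the whole graph. Comparing \<open>A x = sqrt m * x\<close> at the
  leaves and at vertices outside the star leaves no room for another edge that touches the star,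
  and at most one vertex lies outside.
\<close>

lemma (in simple_graph) eq_star_of_star_subset:
  assumes sub: "star c L \<subseteq> R" and c: "c \<notin> L" and L: "card L = m" "m > 0"
    and size: "card V \<le> m + 2"
    and bound: "\<And>f. adj_form R f f \<le> sqrt m * (\<Sum>u\<in>V. (f u)\<^sup>2)"
  shows "R = star c L"
proof -
  define x where "x u = (if u = c then sqrt m else if u \<in> L then 1 else 0)" for u
  have fin: "finite L" and "L \<noteq> {}"
    using L card_ge_0_finite by auto
  then have V: "insert c L \<subseteq> V"
    using sub arcs_subset by (auto simp: star_def)
  have "(\<Sum>u\<in>V. (x u)\<^sup>2) = (\<Sum>u\<in>insert c L. (x u)\<^sup>2)"
    using finite_verts V by (intro sum.mono_neutral_right) (auto simp: x_def)
  also have "\<dots> = m + (\<Sum>u\<in>L. (x u)\<^sup>2)"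
    using fin c by (simp add: x_def)
  also have "(\<Sum>u\<in>L. (x u)\<^sup>2) = (\<Sum>u\<in>L. 1)"
    using c by (intro sum.cong) (auto simp: x_def)
  finally have norm: "(\<Sum>u\<in>V. (x u)\<^sup>2) = 2 * m"
    using L by simp
  have "adj_form (star c L) x x = (\<Sum>(u, v)\<in>{c} \<times> L. x u * x v) + (\<Sum>(u, v)\<in>L \<times> {c}. x u * x v)"
    unfolding adj_form_def star_def using fin c by (intro sum.union_disjoint) auto
  also have "\<dots> = (\<Sum>(u, v)\<in>{c} \<times> L. sqrt m) + (\<Sum>(u, v)\<in>L \<times> {c}. sqrt m)"
    using c by (intro arg_cong2[of _ _ _ _ "(+)"] sum.cong) (auto simp: x_def)
  also have "\<dots> = sqrt m * (2 * m)"
    using L by (simp add: card_cartesian_product)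
  finally have "adj_form (star c L) x x = sqrt m * (2 * m)" .
  moreover have "adj_form (star c L) x x \<le> adj_form R x x"
    unfolding adj_form_def using sub finite_arcs by (intro sum_mono2) (auto simp: x_def)
  ultimately have eigen: "(\<Sum>v\<in>R `` {u}. x v) = sqrt m * x u" if "u \<in> V" for u
    using maximiser_is_eigenvector[OF bound _ that, of x] norm by simp
  have x_nonneg: "x u \<ge> 0" for u
    by (simp add: x_def)
  have outside: "u \<in> insert c L" if uv: "(u, v) \<in> R" for u v
  proof (rule ccontr)
    assume u: "u \<notin> insert c L"
    then have "(\<Sum>v\<in>R `` {u}. x v) = 0"
      using eigen[OF arc_verts(1)[OF uv]] by (simp add: x_def)
    then have "x v = 0"
      using finite_neighbours uv x_nonneg by (subst (asm) sum_nonneg_eq_0_iff) auto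
    then have v: "v \<notin> insert c L"
      using L by (auto simp: x_def split: if_splits)
    have "card (insert u (insert v (insert c L))) \<le> card V"
      using finite_verts V arc_verts[OF uv] by (intro card_mono) auto
    moreover have "card (insert u (insert v (insert c L))) = m + 3"
      using u v c fin L arc_neq[OF uv] by simp
    ultimately show False
      using size by simp
  qed
  have leaf: "v = c" if "u \<in> L" and uv: "(u, v) \<in> R" for u v
  proof (rule ccontr)
    assume "v \<noteq> c"
    then have "x v = 1"
      using outside[OF arc_sym[OF uv]] by (auto simp: x_def)
    have "(u, c) \<in> R"
      using sub \<open>u \<in> L\<close> by (auto simp: star_def)
    then have "(\<Sum>w\<in>{v, c}. x w) \<le> (\<Sum>w\<in>R `` {u}. x w)"
      using uv finite_neighbours x_nonneg by (intro sum_mono2) auto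
    also have "\<dots> = sqrt m"
      using eigen[OF arc_verts(1)[OF uv]] \<open>u \<in> L\<close> c by (auto simp: x_def)
    finally show False
      using \<open>v \<noteq> c\<close> \<open>x v = 1\<close> by (simp add: x_def)
  qed
  have "R \<subseteq> star c L"
  proof (rule subrelI)
    fix u v assume uv: "(u, v) \<in> R"
    show "(u, v) \<in> star c L"
      using outside[OF uv] outside[OF arc_sym[OF uv]] leaf[OF _ uv] arc_neq[OF uv]
      by (auto simp: star_def)
  qed
  with sub show ?thesis by blast
qed

definition non_arcs :: "'a set \<Rightarrow> 'a rel \<Rightarrow> 'a rel" where
  "non_arcs V R = {(u, v). u \<in> V \<and> v \<in> V \<and> u \<noteq> v \<and> (u, v) \<notin> R}"

lemma (in simple_graph) simple_graph_non_arcs: "simple_graph V (non_arcs V R)"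
  using finite_verts arc_sym
  by unfold_locales (auto simp: non_arcs_def sym_def irrefl_def)

lemma (in simple_graph) card_non_neighbours:
  assumes "u \<in> V"
  shows "card (R `` {u}) + card (non_arcs V R `` {u}) + 1 = card V"
proof -
  have V: "V = insert u (R `` {u} \<union> non_arcs V R `` {u})"
    using assms arc_verts by (auto simp: non_arcs_def)
  have "u \<notin> R `` {u} \<union> non_arcs V R `` {u}" "R `` {u} \<inter> non_arcs V R `` {u} = {}"
    using arc_neq by (auto simp: non_arcs_def)
  moreover have "finite (non_arcs V R `` {u})"
    using finite_subset[OF _ finite_verts] by (auto simp: non_arcs_def)
  ultimately have "card (insert u (R `` {u} \<union> non_arcs V R `` {u}))
      = card (R `` {u}) + card (non_arcs V R `` {u}) + 1"
    using finite_neighbours by (simp add: card_Un_disjoint)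
  with V show ?thesis by simp
qed

text \<open>
  The two spectral facts combined. The degree condition on \<open>H\<close> says that adjacent vertices of its
  complement have degree sum at least \<open>m + 1\<close> there, so the complement of \<open>H\<close> is a star, which is
  contained in the complement of \<open>R\<close> and hence equal to it.
\<close>

lemma (in simple_graph) non_arcs_eq_star:
  assumes H: "R \<subseteq> H" "simple_graph V H" and ne: "non_arcs V H \<noteq> {}"
    and deg: "\<And>a b. (a, b) \<in> non_arcs V H \<Longrightarrow> card (H `` {a}) + card (H `` {b}) + m + 3 \<le> 2 * card V"
    and size: "card V * m < (m + 1)\<^sup>2" "card V \<le> m + 2"
    and bound: "\<And>f. adj_form (non_arcs V R) f f \<le> sqrt m * (\<Sum>u\<in>V. (f u)\<^sup>2)"
  obtains c L where "c \<notin> L" "card L = m" "m > 0" "non_arcs V R = star c L"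
proof -
  interpret H: simple_graph V H by fact
  interpret coH: simple_graph V "non_arcs V H"
    by (rule H.simple_graph_non_arcs)
  interpret co: simple_graph V "non_arcs V R"
    by (rule simple_graph_non_arcs)
  have sub: "non_arcs V H \<subseteq> non_arcs V R"
    using H(1) by (auto simp: non_arcs_def)
  have "adj_form (non_arcs V H) f f \<le> sqrt m * (\<Sum>u\<in>V. (f u)\<^sup>2)" for f
  proof -
    have "adj_form (non_arcs V H) f f \<le> adj_form (non_arcs V H) (\<lambda>u. \<bar>f u\<bar>) (\<lambda>u. \<bar>f u\<bar>)"
      unfolding adj_form_def by (rule sum_mono) (auto simp flip: abs_mult)
    also have "\<dots> \<le> adj_form (non_arcs V R) (\<lambda>u. \<bar>f u\<bar>) (\<lambda>u. \<bar>f u\<bar>)"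
      unfolding adj_form_def using sub co.finite_arcs by (intro sum_mono2) auto
    also have "\<dots> \<le> sqrt m * (\<Sum>u\<in>V. (f u)\<^sup>2)"
      using bound[of "\<lambda>u. \<bar>f u\<bar>"] by simp
    finally show ?thesis .
  qed
  moreover have "m + 1 \<le> card (non_arcs V H `` {a}) + card (non_arcs V H `` {b})"
    if ab: "(a, b) \<in> non_arcs V H" for a b
    using deg[OF ab] H.card_non_neighbours[OF coH.arc_verts(1)[OF ab]]
      H.card_non_neighbours[OF coH.arc_verts(2)[OF ab]] by linarith
  ultimately obtain c L where star: "c \<notin> L" "card L = m" "non_arcs V H = star c L"
    using coH.star_of_degree_sums[OF ne _ size(1)] by blast
  have "m > 0"
  proof (rule ccontr)
    assume "\<not> m > 0"
    moreover have "finite L"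
      using coH.finite_arcs finite_subset[of L "non_arcs V H `` {c}"] star coH.finite_neighbours
      by (auto simp: star_def)
    ultimately show False
      using star ne by (simp add: star_def)
  qed
  moreover have "non_arcs V R = star c L"
    using co.eq_star_of_star_subset[of c L m] sub star \<open>m > 0\<close> size(2) bound by simp
  ultimately show thesis
    using star(1,2) by (intro that)
qed

section \<open>Non-Hamiltonian graphs with a sparse complement\<close>

lemma ex_ham_path_of_complete:
  assumes "finite V" "non_arcs V R = {}"
  shows "\<exists>xs. ham_path V R xs"
proof -
  obtain xs where xs: "distinct xs" "set xs = V"
    using finite_distinct_list[OF assms(1)] by blast
  have "successively (\<noteq>) xs"
    using xs(1) by (induction xs) (auto simp: successively_Cons)
  then have "successively (\<lambda>u v. (u, v) \<in> R) xs"
    by (rule successively_mono) (use assms xs in \<open>auto simp: non_arcs_def\<close>)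
  with xs show ?thesis
    by (auto simp: ham_path_def)
qed

lemma ex_ham_cycle_of_complete:
  assumes "finite V" "non_arcs V R = {}" "3 \<le> card V"
  shows "\<exists>xs. ham_cycle V R xs"
proof -
  obtain xs where xs: "ham_path V R xs"
    using ex_ham_path_of_complete[OF assms(1,2)] by blast
  then have len: "length xs = card V" and dist: "distinct xs" and set: "set xs = V"
    by (auto simp: ham_path_def distinct_card)
  obtain x ys where ys: "xs = x # ys" "ys \<noteq> []"
    using len assms(3) by (cases xs; cases "tl xs") auto
  then have "last xs \<noteq> hd xs"
    using dist last_in_set[of ys] by auto
  moreover have "last xs \<in> V" "hd xs \<in> V"
    using ys set by auto
  ultimately have "(last xs, hd xs) \<in> R"
    using assms(2) by (auto simp: non_arcs_def)
  with xs len assms(3) show ?thesis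
    by (auto simp: ham_cycle_def)
qed

text \<open>
  The parameter of \<open>non_arcs_eq_star\<close> is \<open>m = card V - 1\<close>, so the star spans all vertices and its
  centre is isolated in the graph itself.
\<close>

theorem (in simple_graph) non_arcs_star_if_no_ham_path:
  assumes no_path: "\<nexists>xs. ham_path V R xs" and n: "2 \<le> card V"
    and bound: "\<And>f. adj_form (non_arcs V R) f f \<le> sqrt (real (card V) - 1) * (\<Sum>u\<in>V. (f u)\<^sup>2)"
  obtains c where "c \<in> V" "non_arcs V R = star c (V - {c})"
proof -
  obtain H where H: "R \<subseteq> H" "simple_graph V H" "\<nexists>xs. ham_path V H xs"
    and deg: "\<And>u v. u \<in> V \<Longrightarrow> v \<in> V \<Longrightarrow> u \<noteq> v \<Longrightarrow> (u, v) \<notin> H \<Longrightarrow>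
      card (H `` {u}) + card (H `` {v}) + 1 < card V"
    by (rule maximal_supergraph_without_ham_path[OF simple_graph_axioms no_path n]) (rule that)
  define m where "m = card V - 1"
  have m: "card V = m + 1"
    using n by (simp add: m_def)
  have ne: "non_arcs V H \<noteq> {}"
    using ex_ham_path_of_complete[OF finite_verts] H(3) by blast
  have "card (H `` {a}) + card (H `` {b}) + m + 3 \<le> 2 * card V" if "(a, b) \<in> non_arcs V H" for a b
    using deg[of a b] that m by (auto simp: non_arcs_def)
  moreover have "card V * m < (m + 1)\<^sup>2"
    by (simp add: m power2_eq_square)
  moreover have "card V \<le> m + 2"
    by (simp add: m)
  moreover have "adj_form (non_arcs V R) f f \<le> sqrt m * (\<Sum>u\<in>V. (f u)\<^sup>2)" for f
    using bound by (simp add: m)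
  ultimately obtain c L where star: "c \<notin> L" "card L = m" "m > 0" "non_arcs V R = star c L"
    by (rule non_arcs_eq_star[OF H(1,2) ne])
  then obtain l where "l \<in> L"
    by (metis card.empty ex_in_conv less_irrefl)
  with star(4) have "c \<in> V" "L \<subseteq> V - {c}"
    by (auto simp: star_def non_arcs_def)
  moreover from this have "L = V - {c}"
    using star(2) m finite_verts by (intro card_subset_eq) auto
  ultimately show thesis
    using that[of c] star(4) by simp
qed

text \<open>
  Here \<open>m = card V - 2\<close>, so the star misses exactly one vertex \<open>w\<close>, the only neighbour of its
  centre in the graph itself. Two vertices are a separate case: the complete graph on them has
  no Hamiltonian cycle, so a maximal supergraph may have an empty complement. The conclusion
  then holds with a star without leaves.
\<close>

theorem (in simple_graph) non_arcs_star_if_no_ham_cycle: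
  assumes no_cycle: "\<nexists>xs. ham_cycle V R xs" and n: "2 \<le> card V"
    and bound: "\<And>f. adj_form (non_arcs V R) f f \<le> sqrt (real (card V) - 2) * (\<Sum>u\<in>V. (f u)\<^sup>2)"
  obtains c w where "c \<in> V" "w \<in> V" "c \<noteq> w" "non_arcs V R = star c (V - {c, w})"
proof (cases "card V = 2")
  case True
  then obtain c w where V: "V = {c, w}" "c \<noteq> w"
    by (auto simp: card_2_iff)
  interpret co: simple_graph V "non_arcs V R"
    by (rule simple_graph_non_arcs)
  have "non_arcs V R = {}"
    using bound[of "\<lambda>_. 1"] True co.finite_arcs by (simp add: adj_form_def)
  with V show thesis
    by (intro that[of c w]) (auto simp: star_def)
next
  case False
  obtain H where H: "R \<subseteq> H" "simple_graph V H" "\<nexists>xs. ham_cycle V H xs"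
    and deg: "\<And>u v. u \<in> V \<Longrightarrow> v \<in> V \<Longrightarrow> u \<noteq> v \<Longrightarrow> (u, v) \<notin> H \<Longrightarrow>
      card (H `` {u}) + card (H `` {v}) < card V"
    by (rule maximal_supergraph_without_ham_cycle[OF simple_graph_axioms no_cycle]) (rule that)
  define m where "m = card V - 2"
  have m: "card V = m + 2"
    using n by (simp add: m_def)
  have ne: "non_arcs V H \<noteq> {}"
    using ex_ham_cycle_of_complete[OF finite_verts] H(3) False n by force
  have "card (H `` {a}) + card (H `` {b}) + m + 3 \<le> 2 * card V" if "(a, b) \<in> non_arcs V H" for a b
    using deg[of a b] that m by (auto simp: non_arcs_def)
  moreover have "card V * m < (m + 1)\<^sup>2"
    by (simp add: m power2_eq_square)
  moreover have "card V \<le> m + 2"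
    by (simp add: m)
  moreover have "adj_form (non_arcs V R) f f \<le> sqrt m * (\<Sum>u\<in>V. (f u)\<^sup>2)" for f
    using bound by (simp add: m)
  ultimately obtain c L where star: "c \<notin> L" "card L = m" "m > 0" "non_arcs V R = star c L"
    by (rule non_arcs_eq_star[OF H(1,2) ne])
  then obtain l where "l \<in> L"
    by (metis card.empty ex_in_conv less_irrefl)
  with star(4) have cL: "c \<in> V" "L \<subseteq> V - {c}"
    by (auto simp: star_def non_arcs_def)
  then have "card (V - {c} - L) = 1"
    using star(2) m finite_verts finite_subset[OF cL(2)] by (simp add: card_Diff_subset)
  then obtain w where w: "V - {c} - L = {w}"
    by (auto simp: card_1_singleton_iff)
  then have "w \<in> V" "c \<noteq> w" "L = V - {c, w}"
    using cL by blast+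
  with cL star(4) show thesis
    using that[of c w] by simp
qed

lemma digraph_iso_with_projI:
  assumes "pair_wf_digraph G" "bij_betw h (pverts G) (pverts G')"
    and arcs: "\<And>u v. u \<in> pverts G \<Longrightarrow> v \<in> pverts G \<Longrightarrow> (u, v) \<in> parcs G \<longleftrightarrow> (h u, h v) \<in> parcs G'"
    and sub: "parcs G' \<subseteq> pverts G' \<times> pverts G'"
  shows "digraph_iso (with_proj G) (with_proj G')"
proof -
  interpret pair_wf_digraph G by fact
  let ?f = "\<lparr>iso_verts = h, iso_arcs = map_prod h h, iso_head = snd, iso_tail = fst\<rparr>"
  have inj: "inj_on h (pverts G)" and img: "h ` pverts G = pverts G'"
    using assms(2) by (auto simp: bij_betw_def)
  have "inj_on (map_prod h h) (parcs G)"
    using map_prod_inj_on[OF inj inj] by (rule inj_on_subset) (auto dest: in_arcsD1 in_arcsD2)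
  with inj have "pre_digraph.digraph_isomorphism (with_proj G) ?f"
    by (auto simp: pre_digraph.digraph_isomorphism_def wf_digraph_wp_iff assms(1))
  moreover have "map_prod h h ` parcs G = parcs G'"
  proof
    have "(h u, h v) \<in> parcs G'" if "(u, v) \<in> parcs G" for u v
      using arcs[OF in_arcsD1[OF that] in_arcsD2[OF that]] that by blast
    then show "map_prod h h ` parcs G \<subseteq> parcs G'"
      by auto
    show "parcs G' \<subseteq> map_prod h h ` parcs G"
    proof (rule subrelI)
      fix x y assume xy: "(x, y) \<in> parcs G'"
      then have "x \<in> h ` pverts G" "y \<in> h ` pverts G"
        using sub unfolding img by auto
      then obtain u v where uv: "u \<in> pverts G" "v \<in> pverts G" and eq: "x = h u" "y = h v"
        by (elim imageE)
      have "(u, v) \<in> parcs G"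
        using xy arcs[OF uv] unfolding eq by simp
      then show "(x, y) \<in> map_prod h h ` parcs G"
        unfolding eq by (rule map_prod_imageI)
    qed
  qed
  with img have "with_proj G' = app_iso ?f (with_proj G)"
    unfolding app_iso_def with_proj_def by simp
  ultimately show ?thesis
    unfolding digraph_iso_def by (intro exI[of _ ?f] conjI)
qed

lemma parcs_iff_non_arcs:
  assumes "simple_graph (pverts G) (parcs G)"
  shows "(u, v) \<in> parcs G \<longleftrightarrow>
    u \<in> pverts G \<and> v \<in> pverts G \<and> u \<noteq> v \<and> (u, v) \<notin> non_arcs (pverts G) (parcs G)"
  by (auto simp: non_arcs_def dest: simple_graph.arc_verts[OF assms] simple_graph.arc_neq[OF assms])

lemma iso_complete_plus_vertex:
  assumes "pair_wf_digraph G" "simple_graph (pverts G) (parcs G)" "c \<in> pverts G"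
    and star: "non_arcs (pverts G) (parcs G) = star c (pverts G - {c})"
  shows "digraph_iso (with_proj G) (with_proj (complete_plus_vertex (card (pverts G) - 1)))"
proof -
  let ?V = "pverts G"
  define m where "m = card ?V - 1"
  have fin: "finite ?V"
    using assms(2) by (simp add: simple_graph_def)
  have "card (?V - {c}) = card {..<m}"
    using fin assms(3) by (simp add: m_def)
  then obtain g where g: "bij_betw g (?V - {c}) {..<m}"
    using finite_same_card_bij[of "?V - {c}" "{..<m}"] fin by auto
  define h where "h = g(c := m)"
  have hc: "h c = m" and less: "h v < m" if "v \<in> ?V" "v \<noteq> c" for v
    using that bij_betwE[OF g] by (auto simp: h_def)
  have "bij_betw h (?V - {c}) {..<m}"
    using g by (rule bij_betw_cong[THEN iffD1, rotated]) (simp add: h_def)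
  then have h: "bij_betw h ?V (insert m {..<m})"
    using notIn_Un_bij_betw[of c "?V - {c}" h "{..<m}"] assms(3) by (simp add: h_def insert_absorb Un_commute)
  show ?thesis
    unfolding m_def[symmetric]
  proof (rule digraph_iso_with_projI[where h = h])
    show "bij_betw h (pverts G) (pverts (complete_plus_vertex m))"
      using h by (simp add: complete_plus_vertex_def complete_graph_def)
    show "parcs (complete_plus_vertex m)
        \<subseteq> pverts (complete_plus_vertex m) \<times> pverts (complete_plus_vertex m)"
      by (auto simp: complete_plus_vertex_def complete_graph_def)
    fix u v assume uv: "u \<in> ?V" "v \<in> ?V"
    then have "h u = h v \<longleftrightarrow> u = v"
      using h by (auto simp: bij_betw_def dest: inj_onD)
    then show "(u, v) \<in> parcs G \<longleftrightarrow> (h u, h v) \<in> parcs (complete_plus_vertex m)"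
      unfolding parcs_iff_non_arcs[OF assms(2)] star
      using uv less[of u] less[of v]
      by (auto simp: complete_plus_vertex_def complete_graph_def star_def h_def split: if_splits)
  qed fact
qed

lemma iso_complete_plus_edge:
  assumes "pair_wf_digraph G" "simple_graph (pverts G) (parcs G)"
    and cw: "c \<in> pverts G" "w \<in> pverts G" "c \<noteq> w"
    and star: "non_arcs (pverts G) (parcs G) = star c (pverts G - {c, w})"
  shows "digraph_iso (with_proj G) (with_proj (complete_plus_edge (card (pverts G) - 1)))"
proof -
  let ?V = "pverts G"
  define m where "m = card ?V - 1"
  have fin: "finite ?V"
    using assms(2) by (simp add: simple_graph_def)
  have "card {c, w} \<le> card ?V"
    using fin cw by (intro card_mono) auto
  then have "m \<ge> 1"
    using cw by (simp add: m_def)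
  have "card (?V - {c, w}) = card {1..<m}"
    using fin cw by (simp add: m_def card_Diff_subset)
  then obtain g where g: "bij_betw g (?V - {c, w}) {1..<m}"
    using finite_same_card_bij[of "?V - {c, w}" "{1..<m}"] fin by auto
  \<comment> \<open>In the model graph, \<open>m\<close> is the pendent vertex and \<open>0\<close> its neighbour.\<close>
  define h where "h = g(w := 0, c := m)"
  have hcw: "h c = m" "h w = 0"
    using cw by (simp_all add: h_def)
  have less: "0 < h v \<and> h v < m" if "v \<in> ?V" "v \<noteq> c" "v \<noteq> w" for v
    using that bspec[OF bij_betwE[OF g], of v] by (simp add: h_def)
  have "bij_betw h (?V - {c, w}) {1..<m}"
    using g by (rule bij_betw_cong[THEN iffD1, rotated]) (simp add: h_def)
  then have "bij_betw h (?V - {c, w} \<union> {w}) ({1..<m} \<union> {h w})"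
    using notIn_Un_bij_betw[of w "?V - {c, w}" h "{1..<m}"] by (simp add: hcw)
  then have "bij_betw h (?V - {c, w} \<union> {w} \<union> {c}) ({1..<m} \<union> {h w} \<union> {h c})"
    using notIn_Un_bij_betw[of c "?V - {c, w} \<union> {w}" h "{1..<m} \<union> {h w}"] \<open>m \<ge> 1\<close> cw
    by (simp add: hcw)
  moreover have "?V - {c, w} \<union> {w} \<union> {c} = ?V" "{1..<m} \<union> {h w} \<union> {h c} = insert m {..<m}"
    using cw \<open>m \<ge> 1\<close> by (auto simp: hcw)
  ultimately have h: "bij_betw h ?V (insert m {..<m})" by simp
  show ?thesis
    unfolding m_def[symmetric]
  proof (rule digraph_iso_with_projI[where h = h])
    show "bij_betw h (pverts G) (pverts (complete_plus_edge m))"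
      using h by (simp add: complete_plus_edge_def complete_graph_def)
    show "parcs (complete_plus_edge m)
        \<subseteq> pverts (complete_plus_edge m) \<times> pverts (complete_plus_edge m)"
      using \<open>m \<ge> 1\<close> by (auto simp: complete_plus_edge_def complete_graph_def)
    fix u v assume uv: "u \<in> ?V" "v \<in> ?V"
    have *: "u = c \<or> u = w \<or> u \<noteq> c \<and> u \<noteq> w" "v = c \<or> v = w \<or> v \<noteq> c \<and> v \<noteq> w"
      by auto
    have "h u = h v \<longleftrightarrow> u = v"
      using uv h by (auto simp: bij_betw_def dest: inj_onD)
    then show "(u, v) \<in> parcs G \<longleftrightarrow> (h u, h v) \<in> parcs (complete_plus_edge m)"
      unfolding parcs_iff_non_arcs[OF assms(2)] star
      using uv less[of u] less[of v] cw \<open>m \<ge> 1\<close> *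
      by (elim disjE) (auto simp: complete_plus_edge_def complete_graph_def star_def hcw)
  qed fact
qed

lemma walk_of_vertex_list:
  assumes "zs \<noteq> []" "successively (\<lambda>u v. (u, v) \<in> parcs G) zs"
  shows "set (zip zs (tl zs)) \<subseteq> parcs G" "pcas (hd zs) (zip zs (tl zs)) (last zs)"
    "pawalk_verts (hd zs) (zip zs (tl zs)) = zs" "map fst (zip zs (tl zs)) = butlast zs"
  using assms by (induction zs rule: induct_list012) auto

lemma hamiltonian_path_of_ham_path:
  assumes "ham_path (pverts G) (parcs G) xs" "pverts G \<noteq> {}"
  shows "\<exists>u p v. pre_digraph.hamiltonian_path (with_proj G) u p v"
proof -
  have "xs \<noteq> []"
    using assms by (auto simp: ham_path_def)
  from walk_of_vertex_list[OF this, of G] assms(1) this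
  have "pre_digraph.hamiltonian_path (with_proj G) (hd xs) (zip xs (tl xs)) (last xs)"
    by (auto simp: pre_digraph.hamiltonian_path_def pre_digraph.apath_def pre_digraph.awalk_def
      ham_path_def awalk_verts_with_proj_eq cas_with_proj_eq)
  then show ?thesis by blast
qed

lemma hamiltonian_cycle_of_ham_cycle:
  assumes "ham_cycle (pverts G) (parcs G) xs"
  shows "\<exists>p. pre_digraph.hamiltonian_cycle (with_proj G) p"
proof -
  \<comment> \<open>A closed walk visits its first vertex once more at the end.\<close>
  define zs where "zs = xs @ [hd xs]"
  define p where "p = zip zs (tl zs)"
  have "xs \<noteq> []"
    using assms by (auto simp: ham_cycle_def)
  then have "zs \<noteq> []" "successively (\<lambda>u v. (u, v) \<in> parcs G) zs"
    using assms by (auto simp: zs_def ham_cycle_def ham_path_def successively_append_iff)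
  note walk = walk_of_vertex_list[OF this, folded p_def]
  have ends: "hd zs = hd xs" "last zs = hd xs" "butlast zs = xs" "tl zs = tl xs @ [hd xs]"
    using \<open>xs \<noteq> []\<close> by (simp_all add: zs_def)
  have "distinct (tl zs)"
    using assms \<open>xs \<noteq> []\<close> unfolding ends by (cases xs) (auto simp: ham_cycle_def ham_path_def)
  then have "distinct (tl (pawalk_verts (hd xs) p))"
    using walk(3) ends(1) by simp
  moreover have "pcas (hd xs) p (hd xs)"
    using walk(2) unfolding ends .
  moreover have xs: "map fst p = xs"
    using walk(4) unfolding ends .
  have "fst ` set p = pverts G" "3 \<le> length p"
    using assms arg_cong[OF xs, of set] arg_cong[OF xs, of length]
    by (simp_all add: ham_cycle_def ham_path_def)
  moreover from this have "p \<noteq> []"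
    by auto
  moreover have "hd xs \<in> pverts G"
    using assms hd_in_set[OF \<open>xs \<noteq> []\<close>] by (simp add: ham_cycle_def ham_path_def)
  ultimately have "pre_digraph.hamiltonian_cycle (with_proj G) p"
    unfolding pre_digraph.hamiltonian_cycle_def pre_digraph.cycle_def pre_digraph.awalk_def
      with_proj_simps awalk_verts_with_proj_eq cas_with_proj_eq
    using walk(1) by (intro conjI exI[of _ "hd xs"])
  then show ?thesis by blast
qed

lemma simple_graph_of_pair_graph:
  assumes "pair_graph G"
  shows "simple_graph (pverts G) (parcs G)"
proof -
  interpret pair_graph G by fact
  show ?thesis
    using pair_finite_verts in_arcsD1 in_arcsD2 arcs_symmetric
    by unfold_locales (auto simp: sym_def irrefl_def dest: no_loops')
qed

theorem theorem2:
  fixes G :: "'a pair_pre_digraph" and n :: nat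
  assumes "pair_graph G"
    and "card (pverts G) = n"
    and "n \<ge> 2"
  shows "(graph_spectral_radius (complement G) \<le> sqrt (real n - 1) \<longrightarrow>
           \<not> digraph_iso (with_proj G) (with_proj (complete_plus_vertex (n - 1))) \<longrightarrow>
           (\<exists>u p v. pre_digraph.hamiltonian_path (with_proj G) u p v))
       \<and> (graph_spectral_radius (complement G) \<le> sqrt (real n - 2) \<longrightarrow>
           \<not> digraph_iso (with_proj G) (with_proj (complete_plus_edge (n - 1))) \<longrightarrow>
           (\<exists>p. pre_digraph.hamiltonian_cycle (with_proj G) p))"
proof -
  interpret pair_graph G by fact
  have simple: "simple_graph (pverts G) (parcs G)"
    by (rule simple_graph_of_pair_graph) fact
  interpret S: simple_graph "pverts G" "parcs G"
    by (rule simple)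
  have wf: "pair_wf_digraph G" ..
  have ne: "pverts G \<noteq> {}"
    using assms(2,3) by auto
  have bound: "adj_form (non_arcs (pverts G) (parcs G)) f f \<le> s * (\<Sum>u\<in>pverts G. (f u)\<^sup>2)"
    if "graph_spectral_radius (complement G) \<le> s" for s f
  proof -
    have "adj_form (parcs (complement G)) f f
        \<le> graph_spectral_radius (complement G) * (\<Sum>u\<in>pverts G. (f u)\<^sup>2)"
      using rayleigh_le_spectral_radius[OF simple_graph_of_pair_graph[OF pair_graph_complement[OF assms(1)]]]
      by (simp add: complement_def)
    also have "\<dots> \<le> s * (\<Sum>u\<in>pverts G. (f u)\<^sup>2)"
      using that by (intro mult_right_mono sum_nonneg) auto
    finally show ?thesis
      by (simp add: complement_def non_arcs_def)
  qed
  show ?thesis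
  proof (intro conjI impI)
    assume radius: "graph_spectral_radius (complement G) \<le> sqrt (real n - 1)"
      and not_iso: "\<not> digraph_iso (with_proj G) (with_proj (complete_plus_vertex (n - 1)))"
    show "\<exists>u p v. pre_digraph.hamiltonian_path (with_proj G) u p v"
    proof (cases "\<exists>xs. ham_path (pverts G) (parcs G) xs")
      case True
      then show ?thesis
        using hamiltonian_path_of_ham_path ne by blast
    next
      case False
      obtain c where "c \<in> pverts G" "non_arcs (pverts G) (parcs G) = star c (pverts G - {c})"
        by (rule S.non_arcs_star_if_no_ham_path[OF False])
          (use bound[OF radius] assms(2,3) in simp_all)
      with not_iso iso_complete_plus_vertex[OF wf simple] assms(2) show ?thesis by blast
    qed
  next
    assume radius: "graph_spectral_radius (complement G) \<le> sqrt (real n - 2)"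
      and not_iso: "\<not> digraph_iso (with_proj G) (with_proj (complete_plus_edge (n - 1)))"
    show "\<exists>p. pre_digraph.hamiltonian_cycle (with_proj G) p"
    proof (cases "\<exists>xs. ham_cycle (pverts G) (parcs G) xs")
      case True
      then show ?thesis
        using hamiltonian_cycle_of_ham_cycle by blast
    next
      case False
      obtain c w where "c \<in> pverts G" "w \<in> pverts G" "c \<noteq> w"
          "non_arcs (pverts G) (parcs G) = star c (pverts G - {c, w})"
        by (rule S.non_arcs_star_if_no_ham_cycle[OF False])
          (use bound[OF radius] assms(2,3) in simp_all)
      with not_iso iso_complete_plus_edge[OF wf simple] assms(2) show ?thesis by blast
    qed
  qed
qed

end
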